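(* There exists a semigroup $S$ for which $\sim_o$ is a congruence and the quotient semigroup $S/\!\sim_o$ is not cancellative.
   Context: For a semigroup $S$ and $a,b\in S$, $a\sim_o b$ iff there exist $g,h\in S$ such that $ag=gb$ and $bh=ha$; this is an equivalence relation. An equivalence relation $\sim$ on $S$ is a congruence if $a\sim b$ and $c\sim d$ imply $ac\sim bd$ for all $a,b,c,d\in S$. A semigroup is cancellative if it is both left cancellative ($xy=xz\Rightarrow y=z$) and right cancellative ($yx=zx\Rightarrow y=z$). *)

theory Defs
  imports Main
begin

text \<open>HOL's own locale \<open>semigroup\<close> lives on a whole type; here a semigroup has an explicit
  carrier set, so that its quotients are again semigroups in the same sense.\<close>

locale semigroup_on =
  fixes S :: "'a set" and mult :: "'a \<Rightarrow> 'a \<Rightarrow> 'a"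
  assumes closed: "\<lbrakk>x \<in> S; y \<in> S\<rbrakk> \<Longrightarrow> mult x y \<in> S"
    and assoc: "\<lbrakk>x \<in> S; y \<in> S; z \<in> S\<rbrakk> \<Longrightarrow> mult (mult x y) z = mult x (mult y z)"

definition o_conj :: "'a set \<Rightarrow> ('a \<Rightarrow> 'a \<Rightarrow> 'a) \<Rightarrow> 'a rel" where
  "o_conj S mult = {(a, b). a \<in> S \<and> b \<in> S \<and>
     (\<exists>g\<in>S. \<exists>h\<in>S. mult a g = mult g b \<and> mult b h = mult h a)}"

definition congruence_on :: "'a set \<Rightarrow> ('a \<Rightarrow> 'a \<Rightarrow> 'a) \<Rightarrow> 'a rel \<Rightarrow> bool" where
  "congruence_on S mult R \<longleftrightarrow> equiv S R \<and>
     (\<forall>a b c d. (a, b) \<in> R \<longrightarrow> (c, d) \<in> R \<longrightarrow> (mult a c, mult b d) \<in> R)"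

text \<open>Multiplication of classes, on the carrier \<open>S // R\<close>. The closure under \<open>R\<close> is needed since
  the complex product of two classes may be a proper subset of a class
  (see \<open>quot_mult_class\<close> below).\<close>

definition quot_mult :: "('a \<Rightarrow> 'a \<Rightarrow> 'a) \<Rightarrow> 'a rel \<Rightarrow> 'a set \<Rightarrow> 'a set \<Rightarrow> 'a set" where
  "quot_mult mult R X Y = R `` {mult x y | x y. x \<in> X \<and> y \<in> Y}"

definition left_cancellative_on :: "'a set \<Rightarrow> ('a \<Rightarrow> 'a \<Rightarrow> 'a) \<Rightarrow> bool" where
  "left_cancellative_on S mult \<longleftrightarrow>
     (\<forall>x\<in>S. \<forall>y\<in>S. \<forall>z\<in>S. mult x y = mult x z \<longrightarrow> y = z)"

definition right_cancellative_on :: "'a set \<Rightarrow> ('a \<Rightarrow> 'a \<Rightarrow> 'a) \<Rightarrow> bool" where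
  "right_cancellative_on S mult \<longleftrightarrow>
     (\<forall>x\<in>S. \<forall>y\<in>S. \<forall>z\<in>S. mult y x = mult z x \<longrightarrow> y = z)"

definition cancellative_on :: "'a set \<Rightarrow> ('a \<Rightarrow> 'a \<Rightarrow> 'a) \<Rightarrow> bool" where
  "cancellative_on S mult \<longleftrightarrow> left_cancellative_on S mult \<and> right_cancellative_on S mult"

lemma (in semigroup_on) equiv_o_conj: "equiv S (o_conj S mult)"
proof (rule equivI)
  show "o_conj S mult \<subseteq> S \<times> S" by (auto simp: o_conj_def)
  show "refl_on S (o_conj S mult)"
  proof (rule refl_onI)
    fix a assume "a \<in> S"
    then have "\<exists>g\<in>S. \<exists>h\<in>S. mult a g = mult g a \<and> mult a h = mult h a"
      by (intro bexI[of _ a] conjI refl)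
    with \<open>a \<in> S\<close> show "(a, a) \<in> o_conj S mult"
      by (simp add: o_conj_def)
  qed
  show "sym (o_conj S mult)"
  proof (rule symI)
    fix a b assume "(a, b) \<in> o_conj S mult"
    then obtain g h where "a \<in> S" "b \<in> S" "g \<in> S" "h \<in> S" "mult a g = mult g b" "mult b h = mult h a"
      unfolding o_conj_def by blast
    moreover from this have "\<exists>g\<in>S. \<exists>h\<in>S. mult b g = mult g a \<and> mult a h = mult h b"
      by (intro bexI[of _ h] bexI[of _ g] conjI)
    ultimately show "(b, a) \<in> o_conj S mult"
      by (simp add: o_conj_def)
  qed
  show "trans (o_conj S mult)"
  proof (rule transI)
    fix a b c assume "(a, b) \<in> o_conj S mult" "(b, c) \<in> o_conj S mult"
    then obtain g h k l where S: "a \<in> S" "b \<in> S" "c \<in> S" "g \<in> S" "h \<in> S" "k \<in> S" "l \<in> S"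
      and eqs: "mult a g = mult g b" "mult b h = mult h a" "mult b k = mult k c" "mult c l = mult l b"
      unfolding o_conj_def by blast
    have "mult a (mult g k) = mult (mult a g) k" using S by (simp add: assoc)
    also have "\<dots> = mult g (mult b k)" using S eqs(1) by (simp add: assoc)
    also have "\<dots> = mult (mult g k) c" using S eqs(3) by (simp add: assoc)
    finally have ac: "mult a (mult g k) = mult (mult g k) c" .
    have "mult c (mult l h) = mult (mult c l) h" using S by (simp add: assoc)
    also have "\<dots> = mult l (mult b h)" using S eqs(4) by (simp add: assoc)
    also have "\<dots> = mult (mult l h) a" using S eqs(2) by (simp add: assoc)
    finally have "mult c (mult l h) = mult (mult l h) a" .
    with ac have "\<exists>g\<in>S. \<exists>h\<in>S. mult a g = mult g c \<and> mult c h = mult h a"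
      by (intro bexI[of _ "mult g k"] bexI[of _ "mult l h"] conjI) (use S closed in simp_all)
    with S show "(a, c) \<in> o_conj S mult"
      by (simp add: o_conj_def)
  qed
qed

lemma quot_mult_class:
  assumes "congruence_on S mult R" "a \<in> S" "b \<in> S"
  shows "quot_mult mult R (R `` {a}) (R `` {b}) = R `` {mult a b}"
proof -
  have R: "equiv S R"
    and cong: "\<And>x y u v. (x, y) \<in> R \<Longrightarrow> (u, v) \<in> R \<Longrightarrow> (mult x u, mult y v) \<in> R"
    using assms(1) by (simp_all add: congruence_on_def)
  have ab: "(a, a) \<in> R" "(b, b) \<in> R"
    using equiv_class_self[OF R] assms(2,3) by auto
  have tr: "trans R"
    using R by (rule equivE)
  show ?thesis
  proof (rule set_eqI, rule iffI)
    fix z assume "z \<in> quot_mult mult R (R `` {a}) (R `` {b})"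
    then obtain x y where "(a, x) \<in> R" "(b, y) \<in> R" and z: "(mult x y, z) \<in> R"
      unfolding quot_mult_def by blast
    then have "(mult a b, mult x y) \<in> R" by (intro cong)
    from transD[OF tr this z] show "z \<in> R `` {mult a b}" by simp
  next
    fix z assume "z \<in> R `` {mult a b}"
    then have "(mult a b, z) \<in> R" by simp
    moreover from ab have "mult a b \<in> {mult x y | x y. x \<in> R `` {a} \<and> y \<in> R `` {b}}"
      by (intro CollectI exI[of _ a] exI[of _ b]) simp
    ultimately show "z \<in> quot_mult mult R (R `` {a}) (R `` {b})"
      unfolding quot_mult_def by (rule ImageI)
  qed
qed

lemma (in semigroup_on) semigroup_on_quotient:
  assumes "congruence_on S mult R"
  shows "semigroup_on (S // R) (quot_mult mult R)"
proof
  fix X Y assume X: "X \<in> S // R" and Y: "Y \<in> S // R"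
  from X obtain x where "x \<in> S" "X = R `` {x}" by (rule quotientE)
  moreover from Y obtain y where "y \<in> S" "Y = R `` {y}" by (rule quotientE)
  ultimately show "quot_mult mult R X Y \<in> S // R"
    by (simp add: quot_mult_class[OF assms] closed quotientI)
next
  fix X Y Z assume X: "X \<in> S // R" and Y: "Y \<in> S // R" and Z: "Z \<in> S // R"
  from X obtain x where "x \<in> S" "X = R `` {x}" by (rule quotientE)
  moreover from Y obtain y where "y \<in> S" "Y = R `` {y}" by (rule quotientE)
  moreover from Z obtain z where "z \<in> S" "Z = R `` {z}" by (rule quotientE)
  ultimately show "quot_mult mult R (quot_mult mult R X Y) Z = quot_mult mult R X (quot_mult mult R Y Z)"
    by (simp add: quot_mult_class[OF assms] closed assoc)
qed

end

theory Submission imports Defs begin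

text \<open>Since \<open>(a b) a = a (b a)\<close>, every quotient by \<open>\<sim>\<^sub>o\<close> is commutative, so the aim is a quotient
  that is not cancellative because it has a zero class \<open>K\<close> without being trivial.  A zero element
  in \<open>S\<close> itself would make all elements conjugate, so \<open>K\<close> must be a larger ideal.

  Let \<open>K\<close> be a left zero semigroup on which a commutative cancellative semigroup \<open>M\<close> acts from
  the left, and let \<open>S = M \<union> K\<close> with \<open>x m = x\<close> for \<open>x \<in> K\<close>, \<open>m \<in> M\<close>.  Elements of \<open>K\<close> are
  conjugate to each other, and a conjugator \<open>g \<in> K\<close> relates \<open>m \<in> M\<close> to anything only if
  \<open>m g = g\<close>.  If no \<open>m\<close> has a fixed point, then \<open>\<sim>\<^sub>o\<close> is therefore equality on \<open>M\<close> and has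
  \<open>K\<close> as its only other class; it is the Rees congruence of the ideal \<open>K\<close>, and \<open>K\<close> is a
  zero of the quotient.  The simplest such action is the translation action of the positive
  integers; below, \<open>M\<close> is the set of positive even numbers under addition, \<open>K\<close> is the set of odd
  numbers, and \<open>M\<close> translates \<open>K\<close>.\<close>

definition zmult :: "nat \<Rightarrow> nat \<Rightarrow> nat" where
  "zmult x y = (if odd x then x else x + y)"

lemma semigroup_on_zmult: "semigroup_on {0<..} zmult"
  by unfold_locales (auto simp: zmult_def)

text \<open>Translations by positive numbers have no fixed points, and addition is cancellative; hence
  an even number is conjugate to itself only.  Two odd numbers \<open>a\<close>, \<open>b\<close> are conjugate via
  \<open>g = a\<close> and \<open>h = b\<close>.\<close>

lemma o_conj_zmult_iff:
  "(a, b) \<in> o_conj {0<..} zmult \<longleftrightarrow> 0 < a \<and> 0 < b \<and> (a = b \<or> odd a \<and> odd b)"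
proof
  assume "(a, b) \<in> o_conj {0<..} zmult"
  then obtain g h where "0 < a" "0 < b" "zmult a g = zmult g b" "zmult b h = zmult h a"
    unfolding o_conj_def by auto
  then show "0 < a \<and> 0 < b \<and> (a = b \<or> odd a \<and> odd b)"
    by (auto simp: zmult_def split: if_splits)
next
  assume r: "0 < a \<and> 0 < b \<and> (a = b \<or> odd a \<and> odd b)"
  then have "zmult a a = zmult a b \<and> zmult b b = zmult b a"
    by (auto simp: zmult_def)
  with r show "(a, b) \<in> o_conj {0<..} zmult"
    unfolding o_conj_def by auto
qed

lemma congruence_on_zmult: "congruence_on {0<..} zmult (o_conj {0<..} zmult)"
  unfolding congruence_on_def
proof (intro conjI allI impI)
  show "equiv {0<..} (o_conj {0<..} zmult)"
    by (rule semigroup_on.equiv_o_conj[OF semigroup_on_zmult])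
next
  fix a b c d
  assume "(a, b) \<in> o_conj {0<..} zmult" "(c, d) \<in> o_conj {0<..} zmult"
  then show "(zmult a c, zmult b d) \<in> o_conj {0<..} zmult"
    by (auto simp: o_conj_zmult_iff zmult_def)
qed

(* Ranging over carriers inside nat loses nothing: the claim about S is first-order, so by
   downward Loewenheim-Skolem a witness of any cardinality yields a countable one. *)
theorem mainTheorem4:
  "\<exists>(S :: nat set) mult.
     semigroup_on S mult \<and>
     congruence_on S mult (o_conj S mult) \<and>
     \<not> cancellative_on (S // o_conj S mult) (quot_mult mult (o_conj S mult))"
proof -
  let ?S = "{0<..} :: nat set"
  let ?R = "o_conj ?S zmult"
  have "\<not> cancellative_on (?S // ?R) (quot_mult zmult ?R)"
  proof
    assume "cancellative_on (?S // ?R) (quot_mult zmult ?R)"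
    then have canc: "\<And>X Y Z. \<lbrakk>X \<in> ?S // ?R; Y \<in> ?S // ?R; Z \<in> ?S // ?R;
        quot_mult zmult ?R X Y = quot_mult zmult ?R X Z\<rbrakk> \<Longrightarrow> Y = Z"
      unfolding cancellative_on_def left_cancellative_on_def by blast
    \<comment> \<open>The class of 1 is the zero of the quotient; it absorbs the classes of 2 and 4.\<close>
    have "quot_mult zmult ?R (?R `` {1}) (?R `` {2}) = quot_mult zmult ?R (?R `` {1}) (?R `` {4})"
      by (simp add: quot_mult_class[OF congruence_on_zmult] zmult_def)
    then have "?R `` {2} = ?R `` {4}"
      by (rule canc[rotated 3]) (auto intro: quotientI)
    moreover have "2 \<in> ?R `` {2}" and "2 \<notin> ?R `` {4}"
      by (simp_all add: o_conj_zmult_iff)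
    ultimately show False by simp
  qed
  with semigroup_on_zmult congruence_on_zmult show ?thesis
    by (intro exI[of _ ?S] exI[of _ zmult] conjI)
qed

end
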